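(* If $K$ is a compact metric space then for the generic $f\in C(K)$ $$\dim_{tH}\operatorname{graph}(f)=\dim_{tH}K.$$
   Context: $C(K)$ is the space of continuous functions $K\to\mathbb{R}$ with the supremum metric. "The generic $f\in C(K)$ has property $P$" means that the set of $f\in C(K)$ having $P$ is co-meager (its complement is a countable union of nowhere dense sets). $\operatorname{graph}(f)=\{(x,f(x)):x\in K\}\subseteq K\times\mathbb{R}$, where $K\times\mathbb{R}$ has the metric $\sqrt{d_K(x_1,x_2)^2+|y_1-y_2|^2}$. $\dim_H$ is Hausdorff dimension, with the convention $\dim_H\emptyset=-1$. Topological Hausdorff dimension: $\dim_{tH}\emptyset=-1$, and for a non-empty metric space $X$, $\dim_{tH}X=\inf\{d: X$ has a basis $\mathcal{U}$ of open sets such that $\dim_H\partial U\le d-1$ for every $U\in\mathcal{U}\}$. The value $\infty$ is allowed. *)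

theory Defs
  imports "HOL-Analysis.Analysis"
begin

section \<open>Hausdorff dimension\<close>

text \<open>
  Metric spaces are represented as subsets \<open>A\<close> of a type of class \<open>metric_space\<close>.
  Since \<open>0 powr 0 = 0\<close> in HOL, the convention \<open>(diam C)\<^sup>0 = 1\<close> for nonempty \<open>C\<close>
  (so that the case \<open>s = 0\<close> is the counting measure) has to be stated separately.
\<close>

definition diam_power :: "real \<Rightarrow> 'a::metric_space set \<Rightarrow> ennreal" where
  "diam_power s C =
     (if C = {} then 0 else if s = 0 then 1 else ennreal (diameter C powr s))"

text \<open>
  Covers are by sequences; finite covers are included by padding with the empty set.
  Boundedness is required explicitly because \<open>diameter\<close> is unspecified on unbounded sets.
\<close>

definition hausdorff_premeasure :: "real \<Rightarrow> real \<Rightarrow> 'a::metric_space set \<Rightarrow> ennreal" where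
  "hausdorff_premeasure s \<delta> A =
     Inf {(\<Sum>i. diam_power s (C i)) | C :: nat \<Rightarrow> 'a set.
            A \<subseteq> (\<Union>i. C i) \<and> (\<forall>i. bounded (C i) \<and> diameter (C i) \<le> \<delta>)}"

text \<open>The premeasure is antitone in \<open>\<delta>\<close>, so its limit for \<open>\<delta> \<rightarrow> 0\<close> is a supremum.\<close>

definition hausdorff_measure :: "real \<Rightarrow> 'a::metric_space set \<Rightarrow> ennreal" where
  "hausdorff_measure s A = (SUP \<delta>\<in>{0<..}. hausdorff_premeasure s \<delta> A)"

text \<open>In \<open>ereal\<close> the infimum of the empty set is \<open>\<infinity>\<close>.\<close>

definition dim_H :: "'a::metric_space set \<Rightarrow> ereal" where
  "dim_H A = (if A = {} then -1 else Inf {ereal s | s. 0 \<le> s \<and> hausdorff_measure s A = 0})"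


section \<open>Topological Hausdorff dimension\<close>

definition is_base_of :: "'a set set \<Rightarrow> 'a topology \<Rightarrow> bool" where
  "is_base_of \<U> X \<longleftrightarrow> openin X = arbitrary union_of (\<lambda>U. U \<in> \<U>)"

text \<open>Bases and boundaries are those of the subspace topology on \<open>A\<close>, not of the ambient type.\<close>

definition dim_tH :: "'a::metric_space set \<Rightarrow> ereal" where
  "dim_tH A =
     (if A = {} then -1
      else Inf {ereal d | d. \<exists>\<U>. is_base_of \<U> (top_of_set A) \<and>
                               (\<forall>U\<in>\<U>. dim_H (top_of_set A frontier_of U) \<le> ereal (d - 1))})"


section \<open>Baire category\<close>

definition nowhere_dense_in :: "'a topology \<Rightarrow> 'a set \<Rightarrow> bool" where
  "nowhere_dense_in X S \<longleftrightarrow>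
     S \<subseteq> topspace X \<and> X interior_of (X closure_of S) = {}"

definition meager_in :: "'a topology \<Rightarrow> 'a set \<Rightarrow> bool" where
  "meager_in X S \<longleftrightarrow> (\<exists>N :: nat \<Rightarrow> 'a set. (\<forall>n. nowhere_dense_in X (N n)) \<and> S = (\<Union>n. N n))"

definition comeager_in :: "'a topology \<Rightarrow> 'a set \<Rightarrow> bool" where
  "comeager_in X S \<longleftrightarrow> S \<subseteq> topspace X \<and> meager_in X (topspace X - S)"


section \<open>The space of continuous functions and graphs\<close>

text \<open>
  Elements of \<open>cfunspace\<close> are extensional (equal to \<open>undefined\<close> outside \<open>K\<close>), so they
  correspond exactly to functions on \<open>K\<close>; its metric is the supremum metric. It consists of the
  bounded continuous functions, and for compact \<open>K\<close> boundedness is automatic.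
\<close>

definition C_space :: "'a::metric_space set \<Rightarrow> ('a \<Rightarrow> real) metric" where
  "C_space K = cfunspace (top_of_set K) euclidean_metric"

definition generic_in_C :: "'a::metric_space set \<Rightarrow> (('a \<Rightarrow> real) \<Rightarrow> bool) \<Rightarrow> bool" where
  "generic_in_C K P \<longleftrightarrow>
     comeager_in (mtopology_of (C_space K)) {f \<in> mspace (C_space K). P f}"

text \<open>
  The metric of the product type is
  \<open>sqrt ((dist x\<^sub>1 x\<^sub>2)\<^sup>2 + (dist y\<^sub>1 y\<^sub>2)\<^sup>2)\<close>.
\<close>

definition graph_on :: "'a set \<Rightarrow> ('a \<Rightarrow> real) \<Rightarrow> ('a \<times> real) set" where
  "graph_on K f = {(x, f x) | x. x \<in> K}"

end

theory Submission
  imports Defs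
begin

text \<open>
  The projection of \<open>graph(f)\<close> onto \<open>K\<close> is a Lipschitz homeomorphism, so every \<open>f\<close> satisfies
  \<open>dim\<^sub>t\<^sub>H K \<le> dim\<^sub>t\<^sub>H graph(f)\<close>. For the converse, let \<open>C \<subseteq> K\<close> be compact with
  \<open>H\<^sup>s(C) = 0\<close>. The graph of a Lipschitz function over \<open>C\<close> is again null, hence has open covers of
  arbitrarily small \<open>s\<close>-sum; by compactness such a cover also contains the graphs over \<open>C\<close> of all
  nearby functions. As Lipschitz functions are dense, the generic \<open>f\<close> has a null graph over
  \<open>C\<close>, and therefore \<open>dim\<^sub>H graph(f|C) \<le> dim\<^sub>H C\<close>. Apply this to the boundaries of a countable
  base of \<open>K\<close> that is contained in a given base: the graphs over its members form a base of
  \<open>graph(f)\<close>, and their boundaries are the graphs over the boundaries.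
\<close>

section \<open>Hausdorff null sets\<close>

text \<open>One parameter \<open>e\<close> can bound both the diameters and the sum, since a cover
  for a smaller value also serves for a larger one: for a diameter bound \<open>d\<close> and an
  error \<open>e\<close> take their minimum. Nullness thus becomes a family of conditions monotone
  in \<open>e\<close>, of which a sequence \<open>e\<close> \<rightarrow> 0 suffices.\<close>

lemma hausdorff_null_iff:
  "hausdorff_measure s A = 0 \<longleftrightarrow>
     (\<forall>e>0. \<exists>C :: nat \<Rightarrow> 'a::metric_space set. A \<subseteq> (\<Union>i. C i) \<and>
        (\<forall>i. bounded (C i) \<and> diameter (C i) \<le> e) \<and> (\<Sum>i. diam_power s (C i)) < ennreal e)"
  (is "?L \<longleftrightarrow> (\<forall>e>0. ?R e)")
proof
  assume L: ?L
  show "\<forall>e>0. ?R e"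
  proof (intro allI impI)
    fix e :: real assume "e > 0"
    then have "hausdorff_premeasure s e A \<le> hausdorff_measure s A"
      unfolding hausdorff_measure_def by (intro SUP_upper) auto
    then have "hausdorff_premeasure s e A < ennreal e"
      using L \<open>e > 0\<close> by simp
    then show "?R e"
      unfolding hausdorff_premeasure_def Inf_less_iff by blast
  qed
next
  assume R: "\<forall>e>0. ?R e"
  have "hausdorff_premeasure s d A \<le> 0" if "d > 0" for d
  proof (rule ennreal_le_epsilon)
    fix e :: real assume "e > 0"
    then have "min d e > 0" using that by simp
    then obtain C :: "nat \<Rightarrow> 'a set" where C: "A \<subseteq> (\<Union>i. C i)"
      "\<forall>i. bounded (C i) \<and> diameter (C i) \<le> min d e"
      "(\<Sum>i. diam_power s (C i)) < ennreal (min d e)"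
      using R by blast
    have "hausdorff_premeasure s d A \<le> (\<Sum>i. diam_power s (C i))"
      unfolding hausdorff_premeasure_def by (rule Inf_lower) (use C in auto)
    also have "\<dots> \<le> ennreal e"
      using C(3) by (meson ennreal_leI less_imp_le min.cobounded2 order_trans)
    finally show "hausdorff_premeasure s d A \<le> 0 + ennreal e" by simp
  qed
  then show ?L
    unfolding hausdorff_measure_def by (auto intro!: antisym SUP_least)
qed

section \<open>Lipschitz images of null sets\<close>

lemma diameter_lipschitz_image_le:
  assumes "L-lipschitz_on S h" "bounded S"
  shows "bounded (h ` S) \<and> diameter (h ` S) \<le> L * diameter S"
proof -
  have d: "dist (h x) (h y) \<le> L * diameter S" if "x \<in> S" "y \<in> S" for x y
    using lipschitz_onD[OF assms(1) that] diameter_bounded_bound[OF assms(2) that]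
      lipschitz_on_nonneg[OF assms(1)] by (meson mult_left_mono order_trans)
  then have "bounded (h ` S)"
    unfolding bounded_two_points by blast
  moreover have "diameter (h ` S) \<le> L * diameter S"
    using d by (auto simp: diameter_def[of "h ` S"] intro!: cSUP_least
        mult_nonneg_nonneg lipschitz_on_nonneg[OF assms(1)] diameter_ge_0 assms(2))
  ultimately show ?thesis by blast
qed

text \<open>Mapping a cover by \<open>h\<close> multiplies diameters by at most the Lipschitz
  constant, hence the \<open>s\<close>-sum by at most its \<open>s\<close>-th power.\<close>

lemma hausdorff_null_lipschitz_image:
  assumes h: "L-lipschitz_on A h" and null: "hausdorff_measure s A = 0" and "s \<ge> 0"
  shows "hausdorff_measure s (h ` A) = 0"
  unfolding hausdorff_null_iff
proof (intro allI impI)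
  fix e :: real assume "e > 0"
  \<comment> \<open>\<open>L\<close> may be 0; a positive constant is needed to divide by.\<close>
  define M where "M = L + 1"
  have M: "M > 0" "M-lipschitz_on A h"
    using lipschitz_on_nonneg[OF h] lipschitz_on_mono[OF h] by (auto simp: M_def)
  \<comment> \<open>The first entry controls the diameters of the images, the second their
    \<open>s\<close>-sum.\<close>
  define e' where "e' = min (e / M) (e / M powr s)"
  have "e' > 0" using M \<open>e > 0\<close> by (simp add: e'_def)
  then obtain C where C: "A \<subseteq> (\<Union>i. C i)"
      "\<And>i. bounded (C i)" "\<And>i. diameter (C i) \<le> e'"
      "(\<Sum>i. diam_power s (C i)) < ennreal e'"
    using null unfolding hausdorff_null_iff by metis
  \<comment> \<open>The cover is cut down to \<open>A\<close> because \<open>h\<close> is Lipschitz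
    only there.\<close>
  define D where "D i = h ` (A \<inter> C i)" for i
  have bd: "bounded (A \<inter> C i)" for i using C(2) by (meson bounded_subset inf_le2)
  have dd: "diameter (A \<inter> C i) \<le> diameter (C i)" for i
    using C(2) by (intro diameter_subset) auto
  have D: "bounded (D i)" "diameter (D i) \<le> M * diameter (C i)" for i
  proof -
    note * = diameter_lipschitz_image_le[OF lipschitz_on_subset[OF M(2) inf_le1] bd, of i]
    show "bounded (D i)" using * by (simp add: D_def)
    show "diameter (D i) \<le> M * diameter (C i)"
      using * dd[of i] M by (simp add: D_def) (meson less_imp_le mult_left_mono order_trans)
  qed
  have pw: "diam_power s (D i) \<le> ennreal (M powr s) * diam_power s (C i)" for i
  proof (cases "D i = {} \<or> s = 0")
    case True
    then show ?thesis using M by (auto simp: diam_power_def D_def)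
  next
    case False
    then have "C i \<noteq> {}" by (auto simp: D_def)
    have "diameter (D i) powr s \<le> (M * diameter (C i)) powr s"
      by (rule powr_mono2) (use D assms diameter_ge_0 in auto)
    also have "\<dots> = M powr s * diameter (C i) powr s"
      by (rule powr_mult)
    finally show ?thesis
      using False \<open>C i \<noteq> {}\<close> by (auto simp: diam_power_def ennreal_mult[symmetric] intro!: ennreal_leI)
  qed
  have "(\<Sum>i. diam_power s (D i)) \<le> (\<Sum>i. ennreal (M powr s) * diam_power s (C i))"
    by (intro suminf_le pw summableI)
  also have "\<dots> = ennreal (M powr s) * (\<Sum>i. diam_power s (C i))"
    by (rule ennreal_suminf_cmult)
  also have "\<dots> < ennreal (M powr s) * ennreal e'"
    using M C(4) by (intro ennreal_mult_strict_left_mono) auto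
  also have "\<dots> = ennreal (M powr s * e')"
    using \<open>e' > 0\<close> by (simp add: ennreal_mult)
  also have "\<dots> \<le> ennreal e"
  proof (rule ennreal_leI)
    have "M powr s * e' \<le> M powr s * (e / M powr s)"
      by (intro mult_left_mono) (auto simp: e'_def)
    then show "M powr s * e' \<le> e" using M by simp
  qed
  finally have "(\<Sum>i. diam_power s (D i)) < ennreal e" .
  moreover have "diameter (D i) \<le> e" for i
  proof -
    have "M * diameter (C i) \<le> M * (e / M)"
      using C(3)[of i] M by (intro mult_left_mono) (auto simp: e'_def)
    then show ?thesis using D(2)[of i] M by simp
  qed
  moreover have "h ` A \<subseteq> (\<Union>i. D i)" using C(1) unfolding D_def by blast
  ultimately show "\<exists>C. h ` A \<subseteq> (\<Union>i. C i) \<and> (\<forall>i. bounded (C i) \<and> diameter (C i) \<le> e) \<and>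
      (\<Sum>i. diam_power s (C i)) < ennreal e"
    using D(1) by blast
qed

lemma dim_H_lipschitz_image_le:
  assumes "L-lipschitz_on A h"
  shows "dim_H (h ` A) \<le> dim_H A"
  using hausdorff_null_lipschitz_image[OF assms]
  by (auto simp: dim_H_def intro!: Inf_superset_mono)

text \<open>Every nonempty member of a cover contributes 1, so a sum below 1 leaves only empty
  members. This settles the exponent 0, for which shrinking a set does not make its contribution
  small.\<close>

lemma hausdorff_null_0_iff: "hausdorff_measure 0 A = 0 \<longleftrightarrow> A = {}"
proof
  assume "hausdorff_measure 0 A = 0"
  then obtain C :: "nat \<Rightarrow> 'a set" where C: "A \<subseteq> (\<Union>i. C i)" "(\<Sum>i. diam_power 0 (C i)) < 1"
    unfolding hausdorff_null_iff using zero_less_one ennreal_1 by metis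
  have "C i = {}" for i
  proof (rule ccontr)
    assume "C i \<noteq> {}"
    then have "1 \<le> (\<Sum>i\<in>{i}. diam_power 0 (C i))" by (simp add: diam_power_def)
    also have "\<dots> \<le> (\<Sum>i. diam_power 0 (C i))"
      by (intro sum_le_suminf summableI) auto
    finally show False using C(2) by simp
  qed
  then show "A = {}" using C(1) by auto
next
  assume "A = {}"
  then show "hausdorff_measure 0 A = 0"
    by (auto simp: hausdorff_null_iff diam_power_def intro!: exI[of _ "\<lambda>_. {}"])
qed

text \<open>Each nonempty member of a cover is enlarged to a ball about one of its points, of radius
  comparable to its diameter plus a small positive amount; as \<open>s > 0\<close>, these amounts
  can be chosen with summable \<open>s\<close>-powers. Openness is what later lets the cover absorb
  graphs of nearby functions.\<close>

lemma hausdorff_null_open_cover: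
  fixes A :: "'a::metric_space set"
  assumes null: "hausdorff_measure s A = 0" and "s > 0" and "e > 0"
  obtains W where "A \<subseteq> (\<Union>i. W i)" "\<And>i. open (W i)" "\<And>i. bounded (W i)" "\<And>i. diameter (W i) \<le> e"
    "(\<Sum>i. diam_power s (W i)) < ennreal e"
proof -
  \<comment> \<open>The balls below have diameter at most \<open>4 * e'\<close>. Their
    \<open>s\<close>-sum stays below \<open>4 powr s * (2 * e')\<close>, one \<open>e'\<close>
    coming from the sets \<open>C i\<close> and one from the extra radii.\<close>
  define e' where "e' = min (e / 4) (e / (2 * 4 powr s))"
  have "e' > 0" using \<open>e > 0\<close> by (simp add: e'_def)
  then obtain C where C: "A \<subseteq> (\<Union>i. C i)"
      "\<And>i. bounded (C i)" "\<And>i. diameter (C i) \<le> e'"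
      "(\<Sum>i. diam_power s (C i)) < ennreal e'"
    using null unfolding hausdorff_null_iff by metis
  \<comment> \<open>Radii that are positive even where \<open>C i\<close> is a single point, with \<open>\<Sum>i. t i powr s \<le> e'\<close>.\<close>
  define t where "t i = min e' ((e' * (1/2) ^ Suc i) powr (1 / s))" for i
  have t: "t i > 0" "t i \<le> e'" "t i powr s \<le> e' * (1/2) ^ Suc i" for i
  proof -
    show "t i > 0" "t i \<le> e'" using \<open>e' > 0\<close> by (auto simp: t_def)
    have "t i powr s \<le> ((e' * (1/2) ^ Suc i) powr (1 / s)) powr s"
      using \<open>t i > 0\<close> \<open>s > 0\<close> by (intro powr_mono2) (auto simp: t_def)
    also have "\<dots> = e' * (1/2) ^ Suc i"
      using \<open>s > 0\<close> \<open>e' > 0\<close> by (simp add: powr_powr)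
    finally show "t i powr s \<le> e' * (1/2) ^ Suc i" .
  qed
  \<comment> \<open>Doubling makes the radius strictly larger than the diameter, so that the open
    ball contains all of \<open>C i\<close>.\<close>
  define r where "r i = 2 * max (diameter (C i)) (t i)" for i
  define W where "W i = (if C i = {} then {} else ball (SOME x. x \<in> C i) (r i))" for i
  have r: "r i > diameter (C i)" "r i > 0" "r i \<le> 2 * e'" for i
    using t(1,2)[of i] C(3)[of i] diameter_ge_0[OF C(2)[of i]] by (auto simp: r_def max_def)
  have CW: "C i \<subseteq> W i" for i
  proof
    fix x assume x: "x \<in> C i"
    then have "dist (SOME x. x \<in> C i) x \<le> diameter (C i)"
      by (intro diameter_bounded_bound[OF C(2)]) (auto intro: someI)
    then show "x \<in> W i" using x r(1)[of i] by (auto simp: W_def)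
  qed
  have dW: "diameter (W i) \<le> 2 * r i" for i
  proof -
    have "dist x y \<le> 2 * r i" if "x \<in> ball c (r i)" "y \<in> ball c (r i)" for x y c :: 'a
      using that dist_triangle3[of x y c] by (auto simp: dist_commute)
    then have "diameter (ball c (r i)) \<le> 2 * r i" for c :: 'a
      using r(2)[of i] by (auto simp: diameter_def split_beta intro!: cSUP_least)
    then show ?thesis
      using r(2)[of i] by (simp add: W_def)
  qed
  have bW: "bounded (W i)" for i by (auto simp: W_def)
  have pw: "diam_power s (W i) \<le> ennreal (4 powr s) * (diam_power s (C i) + ennreal (e' * (1/2) ^ Suc i))" for i
  proof (cases "C i = {}")
    case True
    then show ?thesis by (simp add: W_def diam_power_def)
  next
    case False
    have "diameter (W i) powr s \<le> (4 * max (diameter (C i)) (t i)) powr s"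
      using dW[of i] \<open>s > 0\<close> diameter_ge_0[OF bW[of i]] by (intro powr_mono2) (auto simp: r_def)
    also have "\<dots> = 4 powr s * max (diameter (C i)) (t i) powr s"
      by (rule powr_mult)
    also have "\<dots> \<le> 4 powr s * (diameter (C i) powr s + e' * (1/2) ^ Suc i)"
      using t(3)[of i] \<open>e' > 0\<close>
      by (intro mult_left_mono) (auto simp: max_def add_increasing add_increasing2)
    finally have "ennreal (diameter (W i) powr s)
        \<le> ennreal (4 powr s * (diameter (C i) powr s + e' * (1/2) ^ Suc i))"
      by (rule ennreal_leI)
    also have "\<dots> = ennreal (4 powr s) * (ennreal (diameter (C i) powr s) + ennreal (e' * (1/2) ^ Suc i))"
      using \<open>e' > 0\<close> by (simp add: ennreal_mult ennreal_plus)
    finally show ?thesis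
      using False CW[of i] \<open>s > 0\<close> by (auto simp: diam_power_def)
  qed
  have "(\<Sum>i. diam_power s (W i))
      \<le> (\<Sum>i. ennreal (4 powr s) * (diam_power s (C i) + ennreal (e' * (1/2) ^ Suc i)))"
    by (intro suminf_le pw summableI)
  also have "\<dots> = ennreal (4 powr s) * ((\<Sum>i. diam_power s (C i)) + ennreal e')"
  proof -
    have "(\<Sum>i. ennreal (e' * (1/2) ^ Suc i)) = ennreal e'"
      using \<open>e' > 0\<close> sums_mult[OF power_half_series, of e'] by (intro suminf_ennreal_eq) auto
    then show ?thesis
      by (simp add: ennreal_suminf_cmult suminf_add[symmetric] del: power_Suc)
  qed
  also have "\<dots> < ennreal (4 powr s) * (ennreal e' + ennreal e')"
    using C(4) by (intro ennreal_mult_strict_left_mono) (auto simp: ennreal_add_left_cancel_less add.commute)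
  also have "\<dots> = ennreal (4 powr s * (2 * e'))"
    using \<open>e' > 0\<close> by (simp add: ennreal_mult flip: ennreal_plus)
  also have "\<dots> \<le> ennreal e"
  proof (rule ennreal_leI)
    have "4 powr s * (2 * e') \<le> 4 powr s * (2 * (e / (2 * 4 powr s)))"
      by (intro mult_left_mono) (auto simp: e'_def)
    then show "4 powr s * (2 * e') \<le> e" by simp
  qed
  finally have sum: "(\<Sum>i. diam_power s (W i)) < ennreal e" .
  have "diameter (W i) \<le> e" for i
  proof -
    have "4 * e' \<le> e" by (simp add: e'_def)
    then show ?thesis using dW[of i] r(3)[of i] by linarith
  qed
  moreover have "open (W i)" for i by (auto simp: W_def)
  moreover have "A \<subseteq> (\<Union>i. W i)" using C(1) CW by blast
  ultimately show ?thesis using that sum bW by blast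
qed


section \<open>Generic continuous functions\<close>

lemma meager_in_subset:
  assumes "meager_in X S" "T \<subseteq> S"
  shows "meager_in X T"
proof -
  obtain N :: "nat \<Rightarrow> 'a set" where N: "\<And>n. nowhere_dense_in X (N n)" "S = (\<Union>n. N n)"
    using assms(1) unfolding meager_in_def by blast
  \<comment> \<open>\<open>meager_in\<close> demands equality with the union, so each piece is
    intersected with \<open>T\<close>.\<close>
  have "nowhere_dense_in X (N n \<inter> T)" for n
    using N(1)[of n] interior_of_mono[OF closure_of_mono[of "N n \<inter> T" "N n" X], of X]
    unfolding nowhere_dense_in_def by blast
  moreover have "T = (\<Union>n. N n \<inter> T)" using assms(2) N(2) by blast
  ultimately show ?thesis
    unfolding meager_in_def by (intro exI[of _ "\<lambda>n. N n \<inter> T"]) blast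
qed

lemma meager_in_UN:
  fixes I :: "'i set" and X :: "'a topology"
  assumes "countable I" "\<And>i. i \<in> I \<Longrightarrow> meager_in X (S i)"
  shows "meager_in X (\<Union>i\<in>I. S i)"
proof (cases "I = {}")
  case True
  have "nowhere_dense_in X {}" by (simp add: nowhere_dense_in_def)
  then show ?thesis using True by (auto simp: meager_in_def intro!: exI[of _ "\<lambda>_. {}"])
next
  case False
  obtain N :: "'i \<Rightarrow> nat \<Rightarrow> 'a set"
    where N: "\<And>i n. i \<in> I \<Longrightarrow> nowhere_dense_in X (N i n)" "\<And>i. i \<in> I \<Longrightarrow> S i = (\<Union>n. N i n)"
    using assms(2) unfolding meager_in_def by metis
  \<comment> \<open>All the nowhere dense pieces, indexed by pairs, are listed in one
    sequence.\<close>
  define M where "M k = N (from_nat_into I (fst (prod_decode k))) (snd (prod_decode k))" for k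
  have "(\<Union>i\<in>I. S i) = (\<Union>k. M k)"
  proof (intro equalityI subsetI)
    fix x assume "x \<in> (\<Union>i\<in>I. S i)"
    then obtain i n where "i \<in> I" "x \<in> N i n" using N(2) by blast
    then have "x \<in> M (prod_encode (to_nat_on I i, n))"
      using assms(1) by (simp add: M_def)
    then show "x \<in> (\<Union>k. M k)" by blast
  next
    fix x assume "x \<in> (\<Union>k. M k)"
    then show "x \<in> (\<Union>i\<in>I. S i)"
      using N(2) from_nat_into[OF False] unfolding M_def by blast
  qed
  moreover have "nowhere_dense_in X (M k)" for k
    using N(1) from_nat_into[OF False] by (simp add: M_def)
  ultimately show ?thesis unfolding meager_in_def by blast
qed

lemma generic_in_C_iff_meager:
  "generic_in_C K P \<longleftrightarrow>
     meager_in (mtopology_of (C_space K)) {f \<in> mspace (C_space K). \<not> P f}"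
proof -
  have "mspace (C_space K) - {f \<in> mspace (C_space K). P f} = {f \<in> mspace (C_space K). \<not> P f}"
    by blast
  then show ?thesis
    by (auto simp: generic_in_C_def comeager_in_def topspace_mtopology_of)
qed

lemma generic_in_C_mono:
  assumes "generic_in_C K P" "\<And>f. f \<in> mspace (C_space K) \<Longrightarrow> P f \<Longrightarrow> Q f"
  shows "generic_in_C K Q"
  unfolding generic_in_C_iff_meager
  by (rule meager_in_subset[OF assms(1)[unfolded generic_in_C_iff_meager]]) (use assms(2) in blast)

lemma generic_in_C_all:
  assumes "countable I" "\<And>i. i \<in> I \<Longrightarrow> generic_in_C K (P i)"
  shows "generic_in_C K (\<lambda>f. \<forall>i\<in>I. P i f)"
proof -
  have "{f \<in> mspace (C_space K). \<not> (\<forall>i\<in>I. P i f)} = (\<Union>i\<in>I. {f \<in> mspace (C_space K). \<not> P i f})"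
    by blast
  moreover have "meager_in (mtopology_of (C_space K)) (\<Union>i\<in>I. {f \<in> mspace (C_space K). \<not> P i f})"
    using assms by (intro meager_in_UN) (auto simp: generic_in_C_iff_meager)
  ultimately show ?thesis unfolding generic_in_C_iff_meager by simp
qed

text \<open>A point \<open>g\<close> with a ball that misses \<open>S\<close> lies outside the
  closure of \<open>S\<close>. If such points occur in every ball, the closure contains no
  ball.\<close>

lemma nowhere_dense_in_mtopology_ofI:
  assumes "\<And>f e. f \<in> mspace m \<Longrightarrow> e > 0 \<Longrightarrow>
    \<exists>g\<in>mspace m. mdist m f g < e \<and> (\<exists>r>0. \<forall>h\<in>mspace m. mdist m g h < r \<longrightarrow> h \<notin> S)"
    and "S \<subseteq> mspace m"
  shows "nowhere_dense_in (mtopology_of m) S"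
proof -
  interpret Metric_space "mspace m" "mdist m" by (rule Metric_space_mspace_mdist)
  have "mtopology interior_of (mtopology closure_of S) = {}"
  proof (rule ccontr)
    assume "mtopology interior_of (mtopology closure_of S) \<noteq> {}"
    then obtain f U where U: "openin mtopology U" "f \<in> U" "U \<subseteq> mtopology closure_of S"
      unfolding interior_of_def by blast
    then obtain e where e: "e > 0" "mball f e \<subseteq> U" "f \<in> mspace m"
      unfolding openin_mtopology by blast
    then obtain g r where g: "g \<in> mspace m" "mdist m f g < e" "r > 0"
        "\<forall>h\<in>mspace m. mdist m g h < r \<longrightarrow> h \<notin> S"
      using assms(1) by blast
    then have "g \<in> mtopology closure_of S" using e U(3) by auto
    then show False using g unfolding metric_closure_of by auto
  qed
  then show ?thesis
    using assms(2) by (simp add: nowhere_dense_in_def mtopology_of_def)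
qed

section \<open>The space C(K) and its Lipschitz functions\<close>

lemma mspace_C_space:
  assumes "compact K"
  shows "f \<in> mspace (C_space K) \<longleftrightarrow> f \<in> extensional K \<and> continuous_on K f"
  using compact_imp_bounded[OF compact_continuous_image[OF _ assms]]
  by (auto simp: C_space_def)

lemma dist_less_if_mdist_C_space_less:
  assumes "f \<in> mspace (C_space K)" "g \<in> mspace (C_space K)" "mdist (C_space K) f g < r" "x \<in> K"
  shows "dist (f x) (g x) < r"
  using mdist_cfunspace_imp_mdist_le[of f "top_of_set K" euclidean_metric g "mdist (C_space K) f g" x] assms
  by (simp add: C_space_def)

text \<open>By Stone-Weierstrass: the Lipschitz functions on \<open>K\<close> form an algebra that
  contains the constants and separates points by means of distance functions.\<close>

lemma lipschitz_dense:
  fixes K :: "'a::metric_space set" and f :: "'a \<Rightarrow> real"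
  assumes "compact K" "continuous_on K f" "e > 0"
  obtains L g where "L-lipschitz_on K g" "\<And>x. x \<in> K \<Longrightarrow> \<bar>f x - g x\<bar> < e"
proof -
  have "\<exists>g. (\<exists>L. L-lipschitz_on K g) \<and> (\<forall>x\<in>K. \<bar>f x - g x\<bar> < e)"
  proof (rule Stone_Weierstrass_HOL)
    show "\<exists>L. L-lipschitz_on K (\<lambda>x. c::real)" for c
      by (blast intro: lipschitz_on_constant)
    show "continuous_on K g" if "\<exists>L. L-lipschitz_on K g" for g :: "'a \<Rightarrow> real"
      using that lipschitz_on_continuous_on by blast
    show "\<exists>L. L-lipschitz_on K (\<lambda>x. g x + h x)"
      if "(\<exists>L. L-lipschitz_on K g) \<and> (\<exists>L. L-lipschitz_on K h)" for g h :: "'a \<Rightarrow> real"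
      using that by (blast intro: lipschitz_on_add)
    show "\<exists>L. L-lipschitz_on K (\<lambda>x. g x * h x)"
      if gh: "(\<exists>L. L-lipschitz_on K g) \<and> (\<exists>L. L-lipschitz_on K h)" for g h :: "'a \<Rightarrow> real"
    proof -
      obtain L M where L: "L-lipschitz_on K g" "M-lipschitz_on K h" using gh by blast
      \<comment> \<open>A product of Lipschitz functions is Lipschitz here because both factors are
        bounded on the compact set \<open>K\<close>.\<close>
      have "bounded (g ` K)" "bounded (h ` K)"
        using L by (auto intro!: compact_imp_bounded compact_continuous_image assms
            intro: lipschitz_on_continuous_on)
      then obtain B B' where B: "B > 0" "\<And>x. x \<in> K \<Longrightarrow> \<bar>g x\<bar> \<le> B" "B' > 0" "\<And>x. x \<in> K \<Longrightarrow> \<bar>h x\<bar> \<le> B'"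
        unfolding bounded_pos by auto
      have "(B * M + B' * L)-lipschitz_on K (\<lambda>x. g x * h x)"
      proof (rule lipschitz_onI)
        fix x y assume xy: "x \<in> K" "y \<in> K"
        have "\<bar>g x * h x - g y * h y\<bar> = \<bar>g x * (h x - h y) + h y * (g x - g y)\<bar>"
          by (simp add: algebra_simps)
        also have "\<dots> \<le> \<bar>g x\<bar> * \<bar>h x - h y\<bar> + \<bar>h y\<bar> * \<bar>g x - g y\<bar>"
          by (metis abs_mult abs_triangle_ineq)
        also have "\<dots> \<le> B * (M * dist x y) + B' * (L * dist x y)"
          using lipschitz_onD[OF L(1) xy] lipschitz_onD[OF L(2) xy] B xy
          by (intro add_mono mult_mono) (auto simp: dist_real_def)
        finally show "dist (g x * h x) (g y * h y) \<le> (B * M + B' * L) * dist x y"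
          by (simp add: dist_real_def algebra_simps)
      qed (use B L lipschitz_on_nonneg in \<open>auto intro!: add_nonneg_nonneg mult_nonneg_nonneg\<close>)
      then show ?thesis by blast
    qed
    show "\<exists>g. (\<exists>L. L-lipschitz_on K g) \<and> g x \<noteq> (g y :: real)" if "x \<in> K \<and> y \<in> K \<and> x \<noteq> y" for x y
    proof (intro exI conjI)
      have "\<bar>dist z x - dist w x\<bar> \<le> dist z w" for z w
        using abs_dist_diff_le[of z x w] by (simp add: dist_commute)
      then show "1-lipschitz_on K (\<lambda>z. dist z x)"
        by (intro lipschitz_onI) (auto simp: dist_real_def)
      show "dist x x \<noteq> dist y x" using that by auto
    qed
  qed (use assms in auto)
  then show ?thesis using that by blast
qed

section \<open>Graphs over a compact subset\<close>

lemma graph_on_eq_image: "graph_on C f = (\<lambda>x. (x, f x)) ` C"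
  by (auto simp: graph_on_def)

text \<open>For each \<open>e > 0\<close>, every ball of C(K) contains a smaller ball of functions
  whose graphs over \<open>C\<close> have a cover of size \<open>e\<close>. Hence the exceptional
  set for \<open>e\<close> is nowhere dense, and the values \<open>1 / real (Suc n)\<close> of
  \<open>e\<close> yield a meager union.\<close>

lemma generic_null_graph:
  fixes K :: "'a::metric_space set"
  assumes K: "compact K" and C: "compact C" "C \<subseteq> K"
    and null: "hausdorff_measure s C = 0" and "s \<ge> 0"
  shows "generic_in_C K (\<lambda>f. hausdorff_measure s (graph_on C f) = 0)"
proof (cases "s = 0")
  case True
  then have "graph_on C f = {}" for f
    using null by (simp add: hausdorff_null_0_iff graph_on_def)
  \<comment> \<open>The conjunction over the empty index set is the trivially true property.\<close>
  then show ?thesis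
    using True generic_in_C_all[of "{}" K "\<lambda>_ _. True"]
    by (simp add: hausdorff_null_0_iff)
next
  case False
  then have "s > 0" using \<open>s \<ge> 0\<close> by simp
  \<comment> \<open>The condition of \<open>hausdorff_null_iff\<close> for the graph and a single
    \<open>e\<close>.\<close>
  define Q where "Q e f \<longleftrightarrow> (\<exists>W :: nat \<Rightarrow> ('a \<times> real) set. graph_on C f \<subseteq> (\<Union>i. W i) \<and>
      (\<forall>i. bounded (W i) \<and> diameter (W i) \<le> e) \<and> (\<Sum>i. diam_power s (W i)) < ennreal e)" for e f
  have nd: "nowhere_dense_in (mtopology_of (C_space K)) {f \<in> mspace (C_space K). \<not> Q e f}"
    if "e > 0" for e
  proof (rule nowhere_dense_in_mtopology_ofI)
    fix f and \<eta> :: real assume f: "f \<in> mspace (C_space K)" and "\<eta> > 0"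
    then have "continuous_on K f" by (simp add: mspace_C_space K)
    \<comment> \<open>Strict pointwise bounds give only a non-strict bound on the supremum distance;
      halving \<eta> restores strictness.\<close>
    then obtain L g0 where g0: "L-lipschitz_on K g0" "\<And>x. x \<in> K \<Longrightarrow> \<bar>f x - g0 x\<bar> < \<eta> / 2"
      using lipschitz_dense[OF K, of f "\<eta> / 2"] \<open>\<eta> > 0\<close> by auto
    \<comment> \<open>Members of \<open>C_space K\<close> have to be extensional.\<close>
    define g where "g = restrict g0 K"
    have g: "L-lipschitz_on K g"
      using g0(1) by (auto simp: g_def lipschitz_on_def)
    then have cg: "continuous_on K g" by (rule lipschitz_on_continuous_on)
    then have gC: "g \<in> mspace (C_space K)"
      by (simp add: mspace_C_space K g_def)
    have "mdist (C_space K) f g \<le> \<eta> / 2"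
      unfolding C_space_def using \<open>\<eta> > 0\<close> g0(2)
      by (intro mdist_cfunspace_le) (auto simp: g_def dist_real_def less_imp_le)
    then have fg: "mdist (C_space K) f g < \<eta>" using \<open>\<eta> > 0\<close> by simp
    have "(sqrt (1\<^sup>2 + L\<^sup>2))-lipschitz_on C (\<lambda>x. (x, g x))"
      using lipschitz_on_subset[OF g C(2)] by (intro lipschitz_on_Pair lipschitz_on_id)
    from hausdorff_null_lipschitz_image[OF this null \<open>s \<ge> 0\<close>]
    have "hausdorff_measure s (graph_on C g) = 0" by (simp add: graph_on_eq_image)
    then obtain W where W: "graph_on C g \<subseteq> (\<Union>i. W i)" "\<And>i. open (W i)" "\<And>i. bounded (W i)"
        "\<And>i. diameter (W i) \<le> e" "(\<Sum>i. diam_power s (W i)) < ennreal e"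
      using hausdorff_null_open_cover \<open>s > 0\<close> \<open>e > 0\<close> by metis
    \<comment> \<open>Compactness yields one radius \<open>r\<close> for the whole graph. If
      \<open>h\<close> is within \<open>r\<close> of \<open>g\<close>, the point
      \<open>(x, h x)\<close> is within \<open>r\<close> of \<open>(x, g x)\<close>, so the same
      sets \<open>W i\<close> cover the graph of \<open>h\<close>.\<close>
    have "compact (graph_on C g)"
      unfolding graph_on_eq_image using C cg
      by (intro compact_continuous_image continuous_on_Pair continuous_on_id)
         (auto intro: continuous_on_subset)
    then obtain r where r: "r > 0" "(\<Union>p\<in>graph_on C g. ball p r) \<subseteq> (\<Union>i. W i)"
      using compact_subset_open_imp_ball_epsilon_subset[of "graph_on C g" "\<Union>i. W i"] W(1,2) by blast
    have "Q e h" if h: "h \<in> mspace (C_space K)" "mdist (C_space K) g h < r" for h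
    proof -
      have "graph_on C h \<subseteq> (\<Union>i. W i)"
      proof
        fix p assume "p \<in> graph_on C h"
        then obtain x where x: "x \<in> C" "p = (x, h x)" by (auto simp: graph_on_def)
        then have "dist (g x) (h x) < r"
          using dist_less_if_mdist_C_space_less[OF gC h(1) h(2)] C(2) by auto
        then have "p \<in> ball (x, g x) r" using x by (simp add: dist_Pair_Pair)
        moreover have "(x, g x) \<in> graph_on C g" using x(1) by (auto simp: graph_on_def)
        ultimately show "p \<in> (\<Union>i. W i)" using r(2) by blast
      qed
      then show ?thesis using W unfolding Q_def by blast
    qed
    then show "\<exists>g\<in>mspace (C_space K). mdist (C_space K) f g < \<eta> \<and> (\<exists>r>0. \<forall>h\<in>mspace (C_space K).
        mdist (C_space K) g h < r \<longrightarrow> h \<notin> {f \<in> mspace (C_space K). \<not> Q e f})"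
      using gC fg r(1) by blast
  qed blast
  \<comment> \<open>A nowhere dense set is meager as the union of a constant sequence.\<close>
  have "generic_in_C K (Q (1 / real (Suc n)))" for n
    unfolding generic_in_C_iff_meager meager_in_def using nd[of "1 / real (Suc n)"]
    by (intro exI[of _ "\<lambda>_. {f \<in> mspace (C_space K). \<not> Q (1 / real (Suc n)) f}"]) auto
  then have "generic_in_C K (\<lambda>f. \<forall>n\<in>UNIV. Q (1 / real (Suc n)) f)"
    by (intro generic_in_C_all) auto
  then show ?thesis
  proof (rule generic_in_C_mono)
    fix f assume Q: "\<forall>n\<in>UNIV. Q (1 / real (Suc n)) f"
    have "Q e f" if e: "e > 0" for e
    proof -
      obtain n where n: "1 / real (Suc n) < e" using nat_approx_posE[OF e] by metis
      then show ?thesis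
        using Q unfolding Q_def
        by (meson UNIV_I ennreal_leI less_imp_le order_less_le_trans order_trans)
    qed
    then show "hausdorff_measure s (graph_on C f) = 0"
      unfolding hausdorff_null_iff Q_def by blast
  qed
qed

text \<open>Genericity survives only countable conjunctions, so the infima that define the
  dimensions have to be reached along countably many exponents.\<close>

lemma ereal_Inf_countable_subset:
  fixes A :: "ereal set"
  obtains B where "countable B" "B \<subseteq> A" "Inf B = Inf A"
proof (cases "A = {}")
  case False
  then obtain f :: "nat \<Rightarrow> ereal" where "range f \<subseteq> A" "Inf A = (INF i. f i)"
    using Inf_countable_INF by metis
  then show ?thesis using that[of "range f"] by simp
qed (use that in auto)

lemma generic_dim_H_graph_le:
  fixes K :: "'a::metric_space set"
  assumes K: "compact K" and C: "compact C" "C \<subseteq> K"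
  shows "generic_in_C K (\<lambda>f. dim_H (graph_on C f) \<le> dim_H C)"
proof -
  obtain B where B: "countable B" "B \<subseteq> {ereal s | s. 0 \<le> s \<and> hausdorff_measure s C = 0}"
      "Inf B = Inf {ereal s | s. 0 \<le> s \<and> hausdorff_measure s C = 0}"
    by (rule ereal_Inf_countable_subset)
  \<comment> \<open>If no exponent is null for \<open>C\<close>, then \<open>B\<close> is empty and
    its infimum is \<infinity>, which makes the bound trivial.\<close>
  have "generic_in_C K (\<lambda>f. \<forall>b\<in>B. hausdorff_measure (real_of_ereal b) (graph_on C f) = 0)"
    using B(2) by (intro generic_in_C_all B(1) generic_null_graph K C) auto
  then show ?thesis
  proof (rule generic_in_C_mono)
    fix f assume null: "\<forall>b\<in>B. hausdorff_measure (real_of_ereal b) (graph_on C f) = 0"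
    show "dim_H (graph_on C f) \<le> dim_H C"
    proof (cases "C = {}")
      case False
      have "dim_H (graph_on C f) \<le> b" if b: "b \<in> B" for b
      proof -
        obtain s where "b = ereal s" "s \<ge> 0" using B(2) b by blast
        then show ?thesis
          using False null b by (auto simp: dim_H_def graph_on_def intro!: Inf_lower)
      qed
      then have "dim_H (graph_on C f) \<le> Inf B" by (rule Inf_greatest)
      then show ?thesis using False B(3) by (simp add: dim_H_def)
    qed (simp add: graph_on_def dim_H_def)
  qed
qed

section \<open>Bases and boundaries\<close>

lemma is_base_of_iff:
  "is_base_of \<U> X \<longleftrightarrow>
     (\<forall>U\<in>\<U>. openin X U) \<and> (\<forall>W x. openin X W \<and> x \<in> W \<longrightarrow> (\<exists>U\<in>\<U>. x \<in> U \<and> U \<subseteq> W))"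
  unfolding is_base_of_def openin_topology_base_unique by blast

lemma is_base_of_homeomorphic_image:
  assumes "is_base_of \<U> X" and h: "homeomorphic_map X Y h"
  shows "is_base_of ((`) h ` \<U>) Y"
  unfolding is_base_of_iff
proof (intro conjI ballI allI impI)
  fix V assume "V \<in> (`) h ` \<U>"
  then show "openin Y V"
    using assms unfolding is_base_of_iff by (auto simp: homeomorphic_map_openness openin_subset)
next
  fix W y assume W: "openin Y W \<and> y \<in> W"
  define W' where "W' = {x \<in> topspace X. h x \<in> W}"
  have surj: "h ` topspace X = topspace Y" using h homeomorphic_imp_surjective_map by blast
  have "openin X W'"
    using W homeomorphic_imp_continuous_map[OF h] by (auto simp: W'_def continuous_map_def)
  moreover obtain x where "x \<in> W'" "y = h x"
    using W surj openin_subset[of Y W] unfolding W'_def by (metis (mono_tags, lifting) imageE mem_Collect_eq subsetD)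
  ultimately obtain U where "U \<in> \<U>" "x \<in> U" "U \<subseteq> W'"
    using assms(1) unfolding is_base_of_iff by blast
  then show "\<exists>V\<in>(`) h ` \<U>. y \<in> V \<and> V \<subseteq> W"
    using \<open>y = h x\<close> by (auto simp: W'_def)
qed

text \<open>A homeomorphism carries bases to bases and frontiers to frontiers, so only the Hausdorff
  dimension of the image frontiers has to be controlled. It is applied both to the graph map and to
  its inverse \<open>fst\<close>.\<close>

lemma dim_tH_le_homeomorphic:
  assumes base: "is_base_of \<U> (top_of_set A)"
    and h: "homeomorphic_map (top_of_set A) (top_of_set B) h"
    and dim: "\<And>U. U \<in> \<U> \<Longrightarrow> dim_H (h ` (top_of_set A frontier_of U)) \<le> ereal (d - 1)"
    and "B \<noteq> {}"
  shows "dim_tH B \<le> ereal d"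
proof -
  have "dim_H (top_of_set B frontier_of V) \<le> ereal (d - 1)" if V: "V \<in> (`) h ` \<U>" for V
  proof -
    obtain U where U: "U \<in> \<U>" "V = h ` U" using V by blast
    then have "U \<subseteq> topspace (top_of_set A)"
      using base openin_subset unfolding is_base_of_iff by blast
    then show ?thesis using U dim homeomorphic_map_frontier_of[OF h] by metis
  qed
  then have "ereal d \<in> {ereal d | d. \<exists>\<U>. is_base_of \<U> (top_of_set B) \<and>
                               (\<forall>U\<in>\<U>. dim_H (top_of_set B frontier_of U) \<le> ereal (d - 1))}"
    using is_base_of_homeomorphic_image[OF base h] by blast
  then show ?thesis using \<open>B \<noteq> {}\<close> unfolding dim_tH_def by (auto intro!: Inf_lower)
qed

section \<open>Comparing the dimensions of \<open>K\<close> and of the graph\<close>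

lemma homeomorphic_map_graph:
  assumes "continuous_on K f"
  shows "homeomorphic_map (top_of_set K) (top_of_set (graph_on K f)) (\<lambda>x. (x, f x))"
    and "homeomorphic_map (top_of_set (graph_on K f)) (top_of_set K) fst"
proof -
  have "homeomorphic_maps (top_of_set K) (top_of_set (graph_on K f)) (\<lambda>x. (x, f x)) fst"
    using assms
    by (auto simp: homeomorphic_maps_def graph_on_def intro!: continuous_intros)
  then show "homeomorphic_map (top_of_set K) (top_of_set (graph_on K f)) (\<lambda>x. (x, f x))"
    "homeomorphic_map (top_of_set (graph_on K f)) (top_of_set K) fst"
    using homeomorphic_maps_map by blast+
qed

text \<open>The projection \<open>fst\<close> is 1-Lipschitz and does not raise the Hausdorff
  dimension of frontiers, so every bound \<open>d\<close> admissible for the graph is admissible for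
  \<open>K\<close>.\<close>

lemma dim_tH_le_dim_tH_graph:
  assumes "continuous_on K f"
  shows "dim_tH K \<le> dim_tH (graph_on K f)"
proof (cases "K = {}")
  case False
  then have "graph_on K f \<noteq> {}" by (simp add: graph_on_def)
  have "dim_tH K \<le> ereal d" if "is_base_of \<U> (top_of_set (graph_on K f))"
     "\<forall>U\<in>\<U>. dim_H (top_of_set (graph_on K f) frontier_of U) \<le> ereal (d - 1)" for d \<U>
  proof (rule dim_tH_le_homeomorphic[OF that(1) homeomorphic_map_graph(2)[OF assms]])
    fix U assume "U \<in> \<U>"
    have "1-lipschitz_on (top_of_set (graph_on K f) frontier_of U) fst"
      by (rule lipschitz_onI) (auto intro: dist_fst_le)
    then show "dim_H (fst ` (top_of_set (graph_on K f) frontier_of U)) \<le> ereal (d - 1)"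
      using dim_H_lipschitz_image_le that(2) \<open>U \<in> \<U>\<close> order_trans by blast
  qed (use False in auto)
  then show ?thesis
    using \<open>graph_on K f \<noteq> {}\<close> unfolding dim_tH_def[of "graph_on K f"] by (auto intro!: Inf_greatest)
qed (simp add: dim_tH_def graph_on_def)

text \<open>For each \<open>n\<close>, finitely many members of the base, each inside a ball of
  radius \<open>1 / real (Suc n)\<close>, cover \<open>K\<close>; together they form a base.
  Choosing from the given base keeps its bound on the frontiers.\<close>

lemma countable_subbase_of_compact:
  fixes K :: "'a::metric_space set"
  assumes "compact K" and base: "is_base_of \<U> (top_of_set K)"
  obtains \<V> where "countable \<V>" "\<V> \<subseteq> \<U>" "is_base_of \<V> (top_of_set K)"
proof -
  have "\<exists>\<F>\<subseteq>\<U>. finite \<F> \<and> K \<subseteq> \<Union>\<F> \<and> (\<forall>U\<in>\<F>. \<exists>c. U \<subseteq> ball c (1 / real (Suc n)))" for n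
  proof -
    let ?\<G> = "{U \<in> \<U>. \<exists>c. U \<subseteq> ball c (1 / real (Suc n))}"
    have "K \<subseteq> \<Union>?\<G>"
    proof
      fix x assume "x \<in> K"
      then have "openin (top_of_set K) (K \<inter> ball x (1 / real (Suc n)))" "x \<in> K \<inter> ball x (1 / real (Suc n))"
        by (auto intro: openin_open_Int)
      then obtain U where "U \<in> \<U>" "x \<in> U" "U \<subseteq> K \<inter> ball x (1 / real (Suc n))"
        using base unfolding is_base_of_iff by meson
      then show "x \<in> \<Union>?\<G>" by blast
    qed
    moreover have "\<forall>U\<in>?\<G>. openin (top_of_set K) U"
      using base unfolding is_base_of_iff by blast
    ultimately obtain \<F> where "\<F> \<subseteq> ?\<G>" "finite \<F>" "K \<subseteq> \<Union>\<F>"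
      using assms(1) unfolding compact_eq_openin_cover by meson
    then show ?thesis by (intro exI[of _ \<F>]) blast
  qed
  then obtain \<F> where \<F>: "\<And>n. \<F> n \<subseteq> \<U>" "\<And>n. finite (\<F> n)" "\<And>n. K \<subseteq> \<Union>(\<F> n)"
      "\<And>n U. U \<in> \<F> n \<Longrightarrow> \<exists>c. U \<subseteq> ball c (1 / real (Suc n))"
    by metis
  have "is_base_of (\<Union>n. \<F> n) (top_of_set K)"
    unfolding is_base_of_iff
  proof (intro conjI ballI allI impI)
    fix U assume "U \<in> (\<Union>n. \<F> n)"
    then show "openin (top_of_set K) U" using \<F>(1) base unfolding is_base_of_iff by blast
  next
    fix W x assume W: "openin (top_of_set K) W \<and> x \<in> W"
    then obtain e where e: "e > 0" "ball x e \<inter> K \<subseteq> W" "x \<in> K"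
      unfolding openin_contains_ball by blast
    \<comment> \<open>Two points of a ball of radius below \<open>e / 2\<close> are less than
      \<open>e\<close> apart, so a member that contains \<open>x\<close> stays inside
      \<open>ball x e\<close>.\<close>
    obtain n where n: "1 / real (Suc n) < e / 2" using nat_approx_posE[of "e / 2"] e(1) by auto
    obtain U where U: "U \<in> \<F> n" "x \<in> U" using \<F>(3) e(3) by blast
    then obtain c where c: "U \<subseteq> ball c (1 / real (Suc n))" using \<F>(4) by blast
    have "U \<subseteq> W"
    proof
      fix y assume "y \<in> U"
      then have "dist c x < e / 2" "dist c y < e / 2" using c U(2) n by (auto simp: subset_iff)
      then have "dist x y < e" using dist_triangle3[of x y c] by (simp add: dist_commute)
      moreover have "openin (top_of_set K) U"
        using U(1) \<F>(1) base unfolding is_base_of_iff by blast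
      then have "y \<in> K" using \<open>y \<in> U\<close> openin_imp_subset by blast
      ultimately show "y \<in> W" using e(2) by auto
    qed
    then show "\<exists>U\<in>\<Union>n. \<F> n. x \<in> U \<and> U \<subseteq> W" using U by blast
  qed
  moreover have "countable (\<Union>n. \<F> n)" using \<F>(2) by (auto intro: countable_finite)
  ultimately show ?thesis using that \<F>(1) by blast
qed

text \<open>Each frontier is closed in \<open>K\<close>, hence compact, and imposes one generic
  condition on \<open>f\<close>; the countable base keeps these conditions countable in
  number.\<close>

lemma generic_dim_tH_graph_le:
  fixes K :: "'a::metric_space set"
  assumes K: "compact K" "K \<noteq> {}" and base: "is_base_of \<U> (top_of_set K)"
    and dim: "\<And>U. U \<in> \<U> \<Longrightarrow> dim_H (top_of_set K frontier_of U) \<le> ereal (d - 1)"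
  shows "generic_in_C K (\<lambda>f. dim_tH (graph_on K f) \<le> ereal d)"
proof -
  obtain \<V> where \<V>: "countable \<V>" "\<V> \<subseteq> \<U>" "is_base_of \<V> (top_of_set K)"
    using countable_subbase_of_compact[OF K(1) base] by blast
  have sub: "top_of_set K frontier_of U \<subseteq> K" for U
    using frontier_of_subset_topspace[of "top_of_set K" U] by simp
  have "compact (top_of_set K frontier_of U)" for U
    using closedin_compact[OF K(1) closedin_frontier_of] .
  then have "generic_in_C K (\<lambda>f. \<forall>U\<in>\<V>. dim_H (graph_on (top_of_set K frontier_of U) f)
      \<le> dim_H (top_of_set K frontier_of U))"
    by (intro generic_in_C_all \<V>(1) generic_dim_H_graph_le K(1) sub)
  then show ?thesis
  proof (rule generic_in_C_mono)
    fix f assume f: "f \<in> mspace (C_space K)" and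
      le: "\<forall>U\<in>\<V>. dim_H (graph_on (top_of_set K frontier_of U) f) \<le> dim_H (top_of_set K frontier_of U)"
    have "continuous_on K f" using f by (simp add: mspace_C_space K)
    then show "dim_tH (graph_on K f) \<le> ereal d"
    proof (intro dim_tH_le_homeomorphic[OF \<V>(3) homeomorphic_map_graph(1)])
      fix U assume "U \<in> \<V>"
      then show "dim_H ((\<lambda>x. (x, f x)) ` (top_of_set K frontier_of U)) \<le> ereal (d - 1)"
        using le dim \<V>(2) unfolding graph_on_eq_image[symmetric] by (meson order_trans subsetD)
    qed (use K in \<open>auto simp: graph_on_def\<close>)
  qed
qed

theorem theorem5p4:
  fixes K :: "'a::metric_space set"
  assumes "compact K"
  shows "generic_in_C K (\<lambda>f. dim_tH (graph_on K f) = dim_tH K)"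
proof (cases "K = {}")
  case True
  then show ?thesis
    using generic_in_C_all[of "{}" K "\<lambda>_ _. True"] by (simp add: graph_on_def dim_tH_def)
next
  case False
  let ?D = "{ereal d | d. \<exists>\<U>. is_base_of \<U> (top_of_set K) \<and>
               (\<forall>U\<in>\<U>. dim_H (top_of_set K frontier_of U) \<le> ereal (d - 1))}"
  \<comment> \<open>Countably many admissible \<open>d\<close> already determine
    \<open>dim_tH K\<close>, and each gives a generic upper bound for the graph.\<close>
  obtain B where B: "countable B" "B \<subseteq> ?D" "Inf B = Inf ?D"
    by (rule ereal_Inf_countable_subset)
  have "generic_in_C K (\<lambda>f. dim_tH (graph_on K f) \<le> b)" if "b \<in> B" for b
  proof -
    have "b \<in> ?D" using B(2) that by blast
    then show ?thesis using generic_dim_tH_graph_le[OF assms False] by blast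
  qed
  then have "generic_in_C K (\<lambda>f. \<forall>b\<in>B. dim_tH (graph_on K f) \<le> b)"
    by (intro generic_in_C_all B(1))
  then show ?thesis
  proof (rule generic_in_C_mono)
    fix f assume f: "f \<in> mspace (C_space K)" and "\<forall>b\<in>B. dim_tH (graph_on K f) \<le> b"
    then have "dim_tH (graph_on K f) \<le> Inf B" by (blast intro: Inf_greatest)
    also have "\<dots> = dim_tH K" using False B(3) by (simp add: dim_tH_def)
    \<comment> \<open>The opposite inequality holds for every continuous \<open>f\<close>, not only
      generically.\<close>
    finally show "dim_tH (graph_on K f) = dim_tH K"
      using dim_tH_le_dim_tH_graph[of K f] f by (simp add: mspace_C_space assms antisym)
  qed
qed

end
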